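(* Let $\mu\in\mathbb R$, $\delta>0$, and let $(X_n)$ be a sequence of iid random variables drawn from some distribution in $\mathcal M_{2+\delta}(\mu)$. Fix $C,\rho>0$ and, for $n\ge2$, let $\hat u_n=n(\hat s_n^2+1/\log n)$. For $\alpha>0$, if $C n^{0.24\,\delta}\ge1/\alpha$ let $$\mathcal H_n^{\mathrm{RWS}}(\alpha;\rho)=(\overline X_n-W_n,\ \overline X_n+W_n),\qquad W_n=W_n^{\mathrm{RWS}}(\alpha;\rho)=\sqrt{\frac{2\rho\hat u_n+2}{n^2\rho}\log\left(\frac{\sqrt{\rho\hat u_n+1}}{\alpha}\right)},$$ and otherwise let $\mathcal H_n^{\mathrm{RWS}}(\alpha;\rho)=\mathbb R$. Then $(\mathcal H_n^{\mathrm{RWS}}(\cdot;\rho))$ is an asymptotic post-hoc confidence interval for $\mu$ (under $\mathcal M_{2+\delta}(\mu)$). If moreover $(X_n)$ has a $\mathcal P$-uniformly bounded $(2+\delta)$-th moment for a class $\mathcal P\subseteq\mathcal M_{2+\delta}(\mu)$, then $(\mathcal H_n^{\mathrm{RWS}}(\cdot;\rho))$ is a $\mathcal P$-uniform asymptotic post-hoc confidence interval for $\mu$.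
   Context: Under $P$, $X_1,X_2,\dots$ are iid with law $P$. $\overline X_n=n^{-1}\sum_{i\le n}X_i$, $\hat s_n^2=n^{-1}\sum_{i\le n}(X_i-\overline X_n)^2$. $\mathcal M_q(\mu)$ is the set of distributions $P$ on $\mathbb R$ with mean $\mu$ and $\mathbb E_P|X_1-\mu|^q<\infty$. $\mathcal P$-uniformly bounded $q$-th moment means $\sup_{P\in\mathcal P}\mathbb E_P|X_1|^q<\infty$. If the logarithm in $W_n$ is negative (possible only for $\alpha>1$), the interval is taken to be empty; an interval $(a,a)$ is empty. For families of random sets $\mathcal H_n=\{\mathcal H_n(\alpha)\}_{\alpha>0}$, let $\mathbf R(\mathcal H_n;\mu,P)=\mathbb E_P\big[\sup_{\alpha>0}\mathbf 1\{\mu\notin\mathcal H_n(\alpha)\}/\alpha\big]$. $(\mathcal H_n)$ is an asymptotic post-hoc confidence interval for $\mu$ under a class $\mathcal Q$ if $\sup_{P\in\mathcal Q}\limsup_{n\to\infty}\mathbf R(\mathcal H_n;\mu,P)\le1$; it is a $\mathcal Q$-uniform one if $\limsup_{n\to\infty}\sup_{P\in\mathcal Q}\mathbf R(\mathcal H_n;\mu,P)\le1$. *)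

theory Defs
  imports "HOL-Probability.Probability"
begin

text \<open>
  A statistical model is a function \<open>M\<close> that sends each law \<open>P\<close> on the reals to a probability
  space \<open>M P\<close>, together with one sequence of observations \<open>X 1, X 2, \<dots>\<close> (\<open>X 0\<close> is never used)
  that does not depend on \<open>P\<close>. The canonical choice is \<open>M P = PiM UNIV (\<lambda>_. P)\<close> with the
  coordinate functions as \<open>X\<close>.
\<close>

definition iid_with_law :: "'a measure \<Rightarrow> (nat \<Rightarrow> 'a \<Rightarrow> real) \<Rightarrow> real measure \<Rightarrow> bool" where
  "iid_with_law S X P \<longleftrightarrow>
     prob_space S \<and>
     prob_space.indep_vars S (\<lambda>_. borel) X {1..} \<and>
     (\<forall>i\<ge>1. distr S borel (X i) = P)"

definition moment_class :: "real \<Rightarrow> real \<Rightarrow> real measure set" where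
  "moment_class q \<mu> =
     {P. prob_space P \<and> sets P = sets borel \<and>
         integrable P (\<lambda>x. x) \<and> (LINT x|P. x) = \<mu> \<and>
         integrable P (\<lambda>x. \<bar>x - \<mu>\<bar> powr q)}"

definition uniformly_bounded_moment :: "real measure set \<Rightarrow> real \<Rightarrow> bool" where
  "uniformly_bounded_moment \<P> q \<longleftrightarrow> (SUP P\<in>\<P>. \<integral>\<^sup>+x. ennreal (\<bar>x\<bar> powr q) \<partial>P) < \<infinity>"

definition post_hoc_risk :: "'a measure \<Rightarrow> real \<Rightarrow> (real \<Rightarrow> 'a \<Rightarrow> real set) \<Rightarrow> ennreal" where
  "post_hoc_risk S \<mu> H =
     (\<integral>\<^sup>+\<omega>. (SUP \<alpha>\<in>{0<..}. ennreal (of_bool (\<mu> \<notin> H \<alpha> \<omega>) / \<alpha>)) \<partial>S)"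

definition asymp_post_hoc_CI ::
    "(real measure \<Rightarrow> 'a measure) \<Rightarrow> real \<Rightarrow> real measure set \<Rightarrow>
     (nat \<Rightarrow> real \<Rightarrow> 'a \<Rightarrow> real set) \<Rightarrow> bool" where
  "asymp_post_hoc_CI M \<mu> \<Q> H \<longleftrightarrow>
     (SUP P\<in>\<Q>. limsup (\<lambda>n. post_hoc_risk (M P) \<mu> (H n))) \<le> 1"

definition uniform_asymp_post_hoc_CI ::
    "(real measure \<Rightarrow> 'a measure) \<Rightarrow> real \<Rightarrow> real measure set \<Rightarrow>
     (nat \<Rightarrow> real \<Rightarrow> 'a \<Rightarrow> real set) \<Rightarrow> bool" where
  "uniform_asymp_post_hoc_CI M \<mu> \<Q> H \<longleftrightarrow>
     limsup (\<lambda>n. SUP P\<in>\<Q>. post_hoc_risk (M P) \<mu> (H n)) \<le> 1"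

definition sample_mean :: "nat \<Rightarrow> (nat \<Rightarrow> real) \<Rightarrow> real" where
  "sample_mean n x = (\<Sum>i=1..n. x i) / real n"

definition sample_var :: "nat \<Rightarrow> (nat \<Rightarrow> real) \<Rightarrow> real" where
  "sample_var n x = (\<Sum>i=1..n. (x i - sample_mean n x)\<^sup>2) / real n"

text \<open>
  Meaningful for \<open>n \<ge> 2\<close> only; the values at \<open>0\<close> and \<open>1\<close> are junk and do not affect any
  limes superior.
\<close>

definition rws_u :: "nat \<Rightarrow> (nat \<Rightarrow> real) \<Rightarrow> real" where
  "rws_u n x = real n * (sample_var n x + 1 / ln (real n))"

definition rws_log :: "real \<Rightarrow> nat \<Rightarrow> real \<Rightarrow> (nat \<Rightarrow> real) \<Rightarrow> real" where
  "rws_log \<rho> n \<alpha> x = ln (sqrt (\<rho> * rws_u n x + 1) / \<alpha>)"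

definition rws_width :: "real \<Rightarrow> nat \<Rightarrow> real \<Rightarrow> (nat \<Rightarrow> real) \<Rightarrow> real" where
  "rws_width \<rho> n \<alpha> x =
     sqrt ((2 * \<rho> * rws_u n x + 2) / ((real n)\<^sup>2 * \<rho>) * rws_log \<rho> n \<alpha> x)"

text \<open>
  If the logarithm is negative, the width is undefined and the interval is empty by convention.
\<close>

definition rws_interval ::
    "real \<Rightarrow> real \<Rightarrow> real \<Rightarrow> nat \<Rightarrow> real \<Rightarrow> (nat \<Rightarrow> real) \<Rightarrow> real set" where
  "rws_interval C \<delta> \<rho> n \<alpha> x =
     (if C * real n powr (0.24 * \<delta>) \<ge> 1 / \<alpha> then
        (if rws_log \<rho> n \<alpha> x < 0 then {}
         else {sample_mean n x - rws_width \<rho> n \<alpha> x <..< sample_mean n x + rws_width \<rho> n \<alpha> x})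
      else UNIV)"

end

theory Submission
  imports Defs "HOL-Real_Asymp.Real_Asymp"
begin

text \<open>
  Write \<open>s\<close> for the sum and \<open>q\<close> for the sum of squares of the centered observations
  \<open>X i - \<mu>\<close> with \<open>i \<le> n\<close>, and \<open>u = q - s\<^sup>2 / n + n / ln n\<close> for the variance proxy. Solving the
  non-coverage event for \<open>1 / \<alpha>\<close> shows that the loss at a sample is at most the smaller of the cap
  \<open>K = C n\<^bsup>0.24 \<delta>\<^esup>\<close> and \<open>exp (\<rho> s\<^sup>2 / (2 (\<rho> u + 1))) / sqrt (\<rho> u + 1)\<close> (\<open>rws_loss_le\<close>). The latter
  is Robbins' mixture: it averages the exponential tilts \<open>exp (l s - l\<^sup>2 u / 2)\<close> over a centered
  normal \<open>l\<close> of variance \<open>\<rho>\<close> (\<open>nn_integral_tilt_eq_gauss_mix\<close>). It remains to see that the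
  expectation of the capped mixture is at most \<open>1 + o(1)\<close>.

  If the tilts had expectation at most 1 for every \<open>l\<close>, then so would the mixture. This is true for
  small \<open>l\<close>. The inequality \<open>exp (x - x\<^sup>2 / 2) \<le> 1 + x + \<bar>x\<bar>\<^bsup>2 + d\<^esup>\<close> for \<open>0 \<le> d \<le> 1\<close>, with
  \<open>d = min \<delta> 1\<close>, bounds the expectation of \<open>exp (l s - l\<^sup>2 q / 2)\<close> by \<open>exp (n m \<bar>l\<bar>\<^bsup>2 + d\<^esup>)\<close>, where
  \<open>m\<close> is one plus a bound on the \<open>(2 + \<delta>)\<close>-th central moment. Half of the regularizer \<open>n / ln n\<close>
  contributes a factor \<open>exp (- l\<^sup>2 n / (4 ln n))\<close>, which outweighs the error as long as
  \<open>m \<bar>l\<bar>\<^sup>d ln n \<le> 1 / 4\<close>, in particular, for large \<open>n\<close>, on \<open>\<bar>l\<bar> \<le> L = n\<^bsup>-0.49\<^esup>\<close>. Hence the tilts by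
  \<open>v = q + n / (2 ln n)\<close> have expectation at most 1 there.

  To pass from \<open>v\<close> to \<open>u\<close> and to dispose of \<open>\<bar>l\<bar> > L\<close>, the sample space is split into three parts
  (\<open>capped_gauss_mix_le\<close>).
  \<^item> If \<open>q > n\<^bsup>1.48\<^esup>\<close>, only the cap is used. By the power mean and Markov inequalities this event has
    probability \<open>O(n\<^bsup>-0.48 - 0.24 \<delta>\<^esup>)\<close>, so it contributes \<open>O(n\<^bsup>-0.48\<^esup>)\<close>; this is where the
    exponent of the cap matters.
  \<^item> If \<open>\<bar>s\<bar> > v L / 2\<close>, one of the tilts at \<open>L / 2\<close> and \<open>- L / 2\<close> is at least
    \<open>exp (n L\<^sup>2 / (16 ln n)) = exp (n\<^bsup>0.02\<^esup> / (16 ln n))\<close>. This beats every power of \<open>n\<close>, so the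
    capped loss contributes \<open>o(1)\<close> again.
  \<^item> Otherwise \<open>\<bar>s\<bar>\<close> is of order at most \<open>n\<^bsup>0.99\<^esup>\<close>, so \<open>s\<^sup>2 / n \<le> n / (2 ln n)\<close> and therefore \<open>v \<le> u\<close>.
    The mixture decreases in its variance argument, and the tilts with \<open>\<bar>l\<bar> > L\<close> are at most 1, so the
    loss is at most an average, over the normal law, of quantities of expectation at most 1.

  All bounds depend on the law only through a bound on its \<open>(2 + \<delta>)\<close>-th central moment. This gives the
  uniform claim, and the pointwise claim is its case of a single law.
\<close>

section \<open>Elementary inequalities\<close>

text \<open>
  The second-order terms of \<open>exp x\<close> and \<open>exp (- x\<^sup>2 / 2)\<close> cancel, so the error is of third order near 0,
  and the left-hand side is bounded, so any power from 2 to 3 absorbs the error globally. No truncation of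
  the observations is then required. For \<open>x \<ge> 0\<close> already \<open>ln (1 + x) \<ge> x - x\<^sup>2 / 2\<close>.
  For \<open>x = - t < 0\<close> the left-hand side is at most \<open>1 / (1 + t + t\<^sup>2)\<close>.
\<close>

lemma exp_minus_half_square_le:
  fixes x d :: real
  assumes "0 \<le> d" "d \<le> 1"
  shows "exp (x - x\<^sup>2 / 2) \<le> 1 + x + \<bar>x\<bar> powr (2 + d)"
proof (cases "x \<ge> 0")
  case True
  have "1 + x \<le> 1 + x + \<bar>x\<bar> powr (2 + d)" by simp
  moreover have "exp (x - x\<^sup>2 / 2) \<le> 1 + x"
  proof -
    define g where "g = (\<lambda>t::real. ln (1 + t) - t + t\<^sup>2 / 2)"
    have "g 0 \<le> g x"
    proof (rule DERIV_nonneg_imp_nondecreasing[OF True])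
      fix t :: real assume t: "0 \<le> t" "t \<le> x"
      have "(g has_real_derivative (t\<^sup>2 / (1 + t))) (at t)"
        unfolding g_def using t
        by (auto intro!: derivative_eq_intros simp: field_simps power2_eq_square)
      then show "\<exists>y. (g has_real_derivative y) (at t) \<and> 0 \<le> y" using t by (auto intro!: exI)
    qed
    then have "x - x\<^sup>2 / 2 \<le> ln (1 + x)" by (simp add: g_def)
    then have "exp (x - x\<^sup>2 / 2) \<le> exp (ln (1 + x))" by (simp only: exp_le_cancel_iff)
    then show ?thesis using True by simp
  qed
  ultimately show ?thesis by linarith
next
  case False
  define t where "t = - x"
  have t: "t > 0" using False by (simp add: t_def)
  have "1 + (t + t\<^sup>2/2) + (t + t\<^sup>2/2)\<^sup>2 / 2 \<le> exp (t + t\<^sup>2/2)"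
    using t by (intro exp_lower_Taylor_quadratic) auto
  moreover have "(t + t\<^sup>2/2)\<^sup>2 / 2 \<ge> t\<^sup>2/2"
    using t by (intro divide_right_mono power_mono) auto
  ultimately have e: "1 + t + t\<^sup>2 \<le> exp (t + t\<^sup>2/2)" by linarith
  have pos: "1 + t + t\<^sup>2 > 0" using t by (simp add: add_pos_pos)
  have "x - x\<^sup>2/2 = - (t + t\<^sup>2/2)" by (simp add: t_def)
  then have "exp (x - x\<^sup>2/2) = 1 / exp (t + t\<^sup>2/2)"
    by (simp only: exp_minus inverse_eq_divide)
  also have "\<dots> \<le> 1 / (1 + t + t\<^sup>2)"
    using e pos by (intro divide_left_mono) auto
  also have "\<dots> \<le> 1 - t + t powr (2 + d)"
  proof -
    have "1 \<le> (1 - t + t powr (2 + d)) * (1 + t + t\<^sup>2)"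
    proof (cases "t \<le> 1")
      case True
      have "t ^ 3 \<le> t powr (2 + d)"
        using t True assms powr_mono'[of "2 + d" 3 t] by simp
      then have "(1 - t + t ^ 3) * (1 + t + t\<^sup>2) \<le> (1 - t + t powr (2 + d)) * (1 + t + t\<^sup>2)"
        using pos by (intro mult_right_mono) auto
      moreover have "(1 - t + t ^ 3) * (1 + t + t\<^sup>2) = 1 + t ^ 4 + t ^ 5" by algebra
      moreover have "t ^ 4 > 0" "t ^ 5 > 0" using t by auto
      ultimately show ?thesis by linarith
    next
      case False
      have "t ^ 2 \<le> t powr (2 + d)"
        using t False assms powr_mono[of 2 "2 + d" t] by simp
      then have "(1 - t + t ^ 2) * (1 + t + t\<^sup>2) \<le> (1 - t + t powr (2 + d)) * (1 + t + t\<^sup>2)"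
        using pos by (intro mult_right_mono) auto
      moreover have "(1 - t + t ^ 2) * (1 + t + t\<^sup>2) = 1 + t ^ 2 + t ^ 4" by algebra
      moreover have "t ^ 2 > 0" "t ^ 4 > 0" using t by auto
      ultimately show ?thesis by linarith
    qed
    then show ?thesis using pos by (simp add: pos_divide_le_eq)
  qed
  finally show ?thesis using t by (simp add: t_def)
qed

lemma powr_ge_tangent:
  fixes p t z :: real
  assumes "p \<ge> 1" "t > 0" "z \<ge> 0"
  shows "t powr p + p * t powr (p - 1) * (z - t) \<le> z powr p"
proof (cases "z = 0")
  case True
  have "t powr (p - 1) * t = t powr p"
    using \<open>t > 0\<close> by (simp add: powr_mult_base mult.commute)
  then have "t powr p + p * t powr (p - 1) * (z - t) = (1 - p) * t powr p"
    using True by (simp add: algebra_simps)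
  also have "\<dots> \<le> 0" using \<open>p \<ge> 1\<close> by (intro mult_nonpos_nonneg) auto
  finally show ?thesis using True by simp
next
  case False
  have "((\<lambda>x. x powr p) has_real_derivative p * t powr (p - 1)) (at t within {0<..})"
    using \<open>t > 0\<close> by (auto intro!: derivative_eq_intros)
  then have "p * t powr (p - 1) * (z - t) \<le> z powr p - t powr p"
    using assms False
    by (intro convex_on_imp_above_tangent[where A = "{0<..}"] powr_convex)
       (auto simp: interior_open)
  then show ?thesis by simp
qed

text \<open>
  A one-sided power mean inequality: averaging the tangent bound at \<open>t\<close>, the linear terms
  add up to something nonnegative.
\<close>

lemma powr_mean_le_mean_powr:
  fixes p t :: real and z :: "nat \<Rightarrow> real"
  assumes "p \<ge> 1" "t > 0" "\<And>i. z i \<ge> 0" "n > 0" "t * real n \<le> (\<Sum>i=1..n. z i)"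
  shows "t powr p \<le> (\<Sum>i=1..n. z i powr p) / real n"
proof -
  have "real n * t powr p \<le> real n * t powr p + p * t powr (p - 1) * ((\<Sum>i=1..n. z i) - t * real n)"
    using assms by simp
  also have "\<dots> = (\<Sum>i=1..n. t powr p + p * t powr (p - 1) * (z i - t))"
    by (simp add: sum.distrib sum_subtractf mult.commute flip: sum_distrib_left sum_distrib_right)
  also have "\<dots> \<le> (\<Sum>i=1..n. z i powr p)"
    using assms by (intro sum_mono powr_ge_tangent) auto
  finally show ?thesis using \<open>n > 0\<close> by (simp add: field_simps)
qed

section \<open>Gaussian mixtures of exponential tilts\<close>

definition tilt :: "real \<Rightarrow> real \<Rightarrow> real \<Rightarrow> real" where
  "tilt l s v = exp (l * s - l\<^sup>2 * v / 2)"

definition gauss_mix :: "real \<Rightarrow> real \<Rightarrow> real \<Rightarrow> real" where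
  "gauss_mix \<rho> s v = exp (\<rho> * s\<^sup>2 / (2 * (\<rho> * v + 1))) / sqrt (\<rho> * v + 1)"

lemma nn_integral_normal_density_eq_1:
  "\<sigma> > 0 \<Longrightarrow> (\<integral>\<^sup>+l. ennreal (normal_density \<mu> \<sigma> l) \<partial>lborel) = 1"
  by (subst nn_integral_eq_integral) (auto simp: normal_density_nonneg)

text \<open>
  Completing the square: the tilted normal density is a multiple of the normal density with mean
  \<open>\<rho> s / (\<rho> v + 1)\<close> and variance \<open>\<rho> / (\<rho> v + 1)\<close>.
\<close>

lemma nn_integral_tilt_eq_gauss_mix:
  assumes "\<rho> > 0" "v \<ge> 0"
  shows "(\<integral>\<^sup>+l. ennreal (normal_density 0 (sqrt \<rho>) l * tilt l s v) \<partial>lborel)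
    = ennreal (gauss_mix \<rho> s v)"
proof -
  define w where "w = \<rho> * v + 1"
  have w: "w > 0" using assms by (simp add: w_def add_nonneg_pos)
  have ex: "- (l\<^sup>2) / (2 * \<rho>) + (l * s - l\<^sup>2 * v / 2)
      = \<rho> * s\<^sup>2 / (2 * w) - (l - \<rho> * s / w)\<^sup>2 / (2 * (\<rho> / w))" for l
  proof -
    have v: "v = (w - 1) / \<rho>" using assms by (simp add: w_def)
    show ?thesis unfolding v using w assms
      by (simp add: field_simps power2_eq_square)
  qed
  have "normal_density 0 (sqrt \<rho>) l * tilt l s v
      = gauss_mix \<rho> s v * normal_density (\<rho> * s / w) (sqrt (\<rho> / w)) l" for l
  proof -
    have "normal_density 0 (sqrt \<rho>) l * tilt l s v
        = 1 / sqrt (2 * pi * \<rho>) * exp (- (l\<^sup>2) / (2 * \<rho>) + (l * s - l\<^sup>2 * v / 2))"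
      using assms by (simp add: normal_density_def tilt_def mult.assoc flip: exp_add)
    also have "\<dots> = 1 / sqrt (2 * pi * \<rho>) * (exp (\<rho> * s\<^sup>2 / (2 * w))
        * exp (- ((l - \<rho> * s / w)\<^sup>2 / (2 * (\<rho> / w)))))"
      unfolding ex diff_conv_add_uminus[of "\<rho> * s\<^sup>2 / (2 * w)"] exp_add ..
    also have "1 / sqrt (2 * pi * \<rho>) = 1 / sqrt w * (1 / sqrt (2 * pi * (\<rho> / w)))"
      using w assms by (simp add: real_sqrt_mult real_sqrt_divide)
    also have "(1 / sqrt w * (1 / sqrt (2 * pi * (\<rho> / w)))) * (exp (\<rho> * s\<^sup>2 / (2 * w))
          * exp (- ((l - \<rho> * s / w)\<^sup>2 / (2 * (\<rho> / w)))))
        = gauss_mix \<rho> s v * normal_density (\<rho> * s / w) (sqrt (\<rho> / w)) l"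
      using w assms by (simp add: normal_density_def gauss_mix_def flip: w_def)
    finally show ?thesis .
  qed
  then have "(\<integral>\<^sup>+l. ennreal (normal_density 0 (sqrt \<rho>) l * tilt l s v) \<partial>lborel)
      = (\<integral>\<^sup>+l. ennreal (gauss_mix \<rho> s v) * ennreal (normal_density (\<rho> * s / w) (sqrt (\<rho> / w)) l) \<partial>lborel)"
    using w by (simp add: gauss_mix_def flip: w_def ennreal_mult')
  also have "\<dots> = ennreal (gauss_mix \<rho> s v)"
    using w assms by (subst nn_integral_cmult) (auto simp: nn_integral_normal_density_eq_1)
  finally show ?thesis .
qed

lemma gauss_mix_antimono:
  assumes "\<rho> > 0" "0 \<le> v" "v \<le> u"
  shows "gauss_mix \<rho> s u \<le> gauss_mix \<rho> s v"
proof -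
  have *: "0 < \<rho> * v + 1" "\<rho> * v + 1 \<le> \<rho> * u + 1"
    using assms by (auto simp: add_nonneg_pos)
  then have "exp (\<rho> * s\<^sup>2 / (2 * (\<rho> * u + 1))) \<le> exp (\<rho> * s\<^sup>2 / (2 * (\<rho> * v + 1)))"
    using assms unfolding exp_le_cancel_iff by (intro divide_left_mono mult_pos_pos) (auto intro: less_le_trans)
  then show ?thesis unfolding gauss_mix_def using *
    by (intro frac_le) auto
qed

text \<open>
  The exponent \<open>l s - l\<^sup>2 v / 2\<close> is nonpositive when \<open>\<bar>s\<bar> \<le> v \<bar>l\<bar> / 2\<close>, so for \<open>\<bar>s\<bar> \<le> v L / 2\<close>
  the tilts beyond \<open>L\<close> are at most 1. The truncated mixture has the advantage that only tilts
  with \<open>\<bar>l\<bar> \<le> L\<close> have to be controlled in expectation.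
\<close>

lemma gauss_mix_le_truncated:
  assumes "\<rho> > 0" "v \<ge> 0" "L > 0" "\<bar>s\<bar> \<le> v * L / 2"
  shows "ennreal (gauss_mix \<rho> s v) \<le>
    (\<integral>\<^sup>+l. ennreal (normal_density 0 (sqrt \<rho>) l * (if \<bar>l\<bar> \<le> L then tilt l s v else 1)) \<partial>lborel)"
proof -
  have "tilt l s v \<le> 1" if "\<bar>l\<bar> > L" for l
  proof -
    have "l * s \<le> \<bar>l * s\<bar>" by (rule abs_ge_self)
    also have "\<dots> \<le> \<bar>l\<bar> * (v * L / 2)"
      unfolding abs_mult using assms(4) by (intro mult_left_mono) auto
    also have "\<dots> \<le> \<bar>l\<bar> * (v * \<bar>l\<bar> / 2)"
      using that assms by (intro mult_left_mono divide_right_mono) auto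
    finally show ?thesis by (simp add: tilt_def power2_eq_square algebra_simps)
  qed
  then have "normal_density 0 (sqrt \<rho>) l * tilt l s v
      \<le> normal_density 0 (sqrt \<rho>) l * (if \<bar>l\<bar> \<le> L then tilt l s v else 1)" for l
    by (intro mult_left_mono) (auto simp: normal_density_nonneg)
  then show ?thesis
    unfolding nn_integral_tilt_eq_gauss_mix[OF assms(1,2), symmetric]
    by (intro nn_integral_mono ennreal_leI)
qed

text \<open>
  The three summands on the right belong to the three cases \<open>q > T\<close>, \<open>\<bar>s\<bar> > v L / 2\<close>, and neither.
  Every summand can be integrated over the sample with tilts at \<open>\<bar>l\<bar> \<le> L\<close> alone, which is why the
  case distinction is made pointwise. Later \<open>N\<close> is the sample size and \<open>h\<close> its logarithm.
\<close>

lemma capped_gauss_mix_le: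
  fixes s q N h T L K :: real
  assumes "\<rho> > 0" "K \<ge> 0" "L > 0" "N > 0" "h > 0" "q \<ge> 0"
    and T: "(T + N / (2 * h)) * L / 2 \<le> N / sqrt (2 * h)"
  defines "v \<equiv> q + N / (2 * h)"
    and "u \<equiv> q - s\<^sup>2 / N + N / h"
  shows "ennreal (min (gauss_mix \<rho> s u) K) \<le>
    ennreal (K * of_bool (T < q))
    + ennreal (K * exp (- (N * L\<^sup>2 / (16 * h)))) * (ennreal (tilt (L/2) s v) + ennreal (tilt (-L/2) s v))
    + (\<integral>\<^sup>+l. ennreal (normal_density 0 (sqrt \<rho>) l * (if \<bar>l\<bar> \<le> L then tilt l s v else 1)) \<partial>lborel)"
    (is "?E \<le> ?A + ?B + ?D")
proof -
  have v: "v \<ge> N / (2 * h)" "v > 0" using assms by (auto simp: v_def add_nonneg_pos)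
  consider "T < q" | "\<bar>s\<bar> > v * L / 2" | "q \<le> T" "\<bar>s\<bar> \<le> v * L / 2" by linarith
  then show ?thesis
  proof cases
    case 1
    then have "?E \<le> ?A" by (auto intro!: ennreal_leI)
    then show ?thesis by (simp add: add_increasing2 add.assoc)
  next
    case 2
    \<comment> \<open>The tilt at half the truncation level, with the sign of \<open>s\<close>, is large.\<close>
    define r where "r = (if s \<ge> 0 then L / 2 else - L / 2)"
    have r: "r * s = L / 2 * \<bar>s\<bar>" "r\<^sup>2 = L\<^sup>2 / 4"
      by (auto simp: r_def power2_eq_square)
    have "N * L\<^sup>2 / (16 * h) = N / (2 * h) * L\<^sup>2 / 8" by simp
    also have "\<dots> \<le> v * L\<^sup>2 / 8" using v by (intro divide_right_mono mult_right_mono) auto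
    also have "\<dots> = L / 2 * (v * L / 2) - L\<^sup>2 / 4 * v / 2" by (simp add: power2_eq_square field_simps)
    also have "\<dots> \<le> r * s - r\<^sup>2 * v / 2"
      unfolding r using 2 \<open>L > 0\<close> by (intro diff_right_mono mult_left_mono) auto
    finally have "exp (N * L\<^sup>2 / (16 * h)) \<le> tilt r s v" by (simp add: tilt_def)
    then have "1 \<le> exp (- (N * L\<^sup>2 / (16 * h))) * tilt r s v"
      by (simp add: exp_minus field_simps)
    also have "tilt r s v \<le> tilt (L/2) s v + tilt (-L/2) s v"
      by (auto simp: r_def tilt_def)
    finally have "K * 1 \<le> K * (exp (- (N * L\<^sup>2 / (16 * h))) * (tilt (L/2) s v + tilt (-L/2) s v))"
      using \<open>K \<ge> 0\<close> by (intro mult_left_mono) auto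
    then have "?E \<le> ennreal (K * exp (- (N * L\<^sup>2 / (16 * h))) * (tilt (L/2) s v + tilt (-L/2) s v))"
      by (intro ennreal_leI) (simp add: mult.assoc min.coboundedI2)
    also have "\<dots> = ?B"
      using \<open>K \<ge> 0\<close> by (simp add: ennreal_mult tilt_def)
    finally show ?thesis by (simp add: add_increasing2 add_increasing)
  next
    case 3
    \<comment> \<open>Here \<open>s\<^sup>2 / N\<close> uses up at most half of the regularizer \<open>N / h\<close>, so \<open>v \<le> u\<close>.\<close>
    have "\<bar>s\<bar> \<le> v * L / 2" by fact
    also have "\<dots> \<le> (T + N / (2 * h)) * L / 2"
      unfolding v_def using 3 \<open>L > 0\<close> by (intro divide_right_mono mult_right_mono) auto
    also note T
    finally have "\<bar>s\<bar>\<^sup>2 \<le> (N / sqrt (2 * h))\<^sup>2" by (intro power_mono) auto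
    also have "\<dots> = N\<^sup>2 / (2 * h)" using \<open>h > 0\<close> by (simp add: power_divide)
    finally have "s\<^sup>2 / N \<le> N\<^sup>2 / (2 * h) / N" using \<open>N > 0\<close> by (intro divide_right_mono) auto
    also have "\<dots> = N / h - N / (2 * h)" using \<open>N > 0\<close> \<open>h > 0\<close> by (simp add: field_simps power2_eq_square)
    finally have "v \<le> u" by (simp add: v_def u_def)
    then have "min (gauss_mix \<rho> s u) K \<le> gauss_mix \<rho> s v"
      using gauss_mix_antimono[of \<rho> v u s] v \<open>\<rho> > 0\<close> by linarith
    then have "?E \<le> ennreal (gauss_mix \<rho> s v)" by (rule ennreal_leI)
    also have "\<dots> \<le> ?D" using v 3 \<open>\<rho> > 0\<close> \<open>L > 0\<close> by (intro gauss_mix_le_truncated) auto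
    finally show ?thesis by (simp add: add_increasing)
  qed
qed

section \<open>The loss at a fixed sample\<close>

lemma real_mult_sample_var:
  fixes x :: "nat \<Rightarrow> real" and \<mu> :: real
  assumes "n > 0"
  shows "real n * sample_var n x = (\<Sum>i=1..n. (x i - \<mu>)\<^sup>2) - (\<Sum>i=1..n. x i - \<mu>)\<^sup>2 / real n"
proof -
  define m where "m = sample_mean n x - \<mu>"
  have s: "(\<Sum>i=1..n. x i - \<mu>) = real n * m"
    using assms by (simp add: m_def sample_mean_def sum_subtractf algebra_simps)
  have "real n * sample_var n x = (\<Sum>i=1..n. ((x i - \<mu>) - m)\<^sup>2)"
    using assms by (simp add: sample_var_def m_def)
  also have "\<dots> = (\<Sum>i=1..n. (x i - \<mu>)\<^sup>2 - 2 * m * (x i - \<mu>) + m\<^sup>2)"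
    by (intro sum.cong) (auto simp: power2_eq_square algebra_simps)
  also have "\<dots> = (\<Sum>i=1..n. (x i - \<mu>)\<^sup>2) - 2 * m * (\<Sum>i=1..n. x i - \<mu>) + real n * m\<^sup>2"
    by (simp add: sum.distrib sum_subtractf flip: sum_distrib_left)
  also have "\<dots> = (\<Sum>i=1..n. (x i - \<mu>)\<^sup>2) - (\<Sum>i=1..n. x i - \<mu>)\<^sup>2 / real n"
    unfolding s using assms by (simp add: power2_eq_square field_simps)
  finally show ?thesis .
qed

lemma rws_u_eq:
  assumes "n > 0"
  shows "rws_u n x = (\<Sum>i=1..n. (x i - \<mu>)\<^sup>2) - (\<Sum>i=1..n. x i - \<mu>)\<^sup>2 / real n + real n / ln (real n)"
  using real_mult_sample_var[OF assms, of x \<mu>] by (simp add: rws_u_def distrib_left)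

lemma rws_u_nonneg:
  assumes "n \<ge> 2"
  shows "rws_u n x \<ge> 0"
  using assms by (auto simp: rws_u_def sample_var_def intro!: mult_nonneg_nonneg add_nonneg_nonneg divide_nonneg_nonneg sum_nonneg)

text \<open>
  Non-coverage means \<open>s\<^sup>2 / n\<^sup>2 \<ge> W\<^sup>2\<close> for the half-width \<open>W\<close>; solved for the logarithm this is
  \<open>ln (sqrt (\<rho> u + 1) / \<alpha>) \<le> \<rho> s\<^sup>2 / (2 (\<rho> u + 1))\<close>. The empty interval at a negative logarithm obeys
  the same inequality, because the right-hand side is nonnegative. The cap comes from the levels at
  which the interval is the whole line.
\<close>

lemma rws_loss_le:
  fixes x :: "nat \<Rightarrow> real" and \<mu> :: real
  assumes "\<rho> > 0" "n \<ge> 2" "\<alpha> > 0" and miss: "\<mu> \<notin> rws_interval C \<delta> \<rho> n \<alpha> x"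
  shows "1 / \<alpha> \<le> min (gauss_mix \<rho> (\<Sum>i=1..n. x i - \<mu>) (rws_u n x)) (C * real n powr (0.24 * \<delta>))"
proof -
  define s where "s = (\<Sum>i=1..n. x i - \<mu>)"
  define w where "w = \<rho> * rws_u n x + 1"
  define l where "l = rws_log \<rho> n \<alpha> x"
  have w: "w > 0" using assms rws_u_nonneg[of n x] by (simp add: w_def add_nonneg_pos)
  have bound: "1 / \<alpha> \<le> C * real n powr (0.24 * \<delta>)"
    using miss by (auto simp: rws_interval_def split: if_splits)
  have "l \<le> \<rho> * s\<^sup>2 / (2 * w)"
  proof (cases "l < 0")
    case True
    then have "0 \<le> \<rho> * s\<^sup>2 / (2 * w)" using w \<open>\<rho> > 0\<close> by simp
    with True show ?thesis by simp
  next
    case False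
    define W where "W = rws_width \<rho> n \<alpha> x"
    have "\<mu> \<notin> {sample_mean n x - W <..< sample_mean n x + W}"
      using miss False by (auto simp: rws_interval_def l_def W_def split: if_splits)
    then have "W \<le> \<bar>sample_mean n x - \<mu>\<bar>" by auto
    also have "sample_mean n x - \<mu> = s / real n"
      using assms by (simp add: s_def sample_mean_def sum_subtractf field_simps)
    finally have W: "W \<le> \<bar>s / real n\<bar>" .
    have W2: "W = sqrt (2 * w / ((real n)\<^sup>2 * \<rho>) * l)"
      by (simp add: W_def rws_width_def l_def w_def algebra_simps)
    have nn: "0 \<le> 2 * w / ((real n)\<^sup>2 * \<rho>) * l"
      using w False \<open>\<rho> > 0\<close> by (intro mult_nonneg_nonneg divide_nonneg_nonneg) auto
    have "W\<^sup>2 \<le> \<bar>s / real n\<bar>\<^sup>2" using W nn by (intro power_mono) (auto simp: W2)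
    then have "2 * w / ((real n)\<^sup>2 * \<rho>) * l \<le> s\<^sup>2 / (real n)\<^sup>2"
      using nn by (simp add: W2 power_divide)
    then show ?thesis using w assms by (simp add: field_simps)
  qed
  then have "exp l \<le> exp (\<rho> * s\<^sup>2 / (2 * w))" by simp
  moreover have "exp l = sqrt w / \<alpha>"
    using w \<open>\<alpha> > 0\<close> by (simp add: l_def rws_log_def flip: w_def)
  ultimately have "1 / \<alpha> \<le> exp (\<rho> * s\<^sup>2 / (2 * w)) / sqrt w"
    using w \<open>\<alpha> > 0\<close> by (simp add: field_simps)
  then show ?thesis using bound unfolding gauss_mix_def w_def s_def by simp
qed

lemma SUP_rws_loss_le:
  fixes x :: "nat \<Rightarrow> real" and \<mu> :: real
  assumes "\<rho> > 0" "n \<ge> 2"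
  shows "(SUP \<alpha>\<in>{0<..}. ennreal (of_bool (\<mu> \<notin> rws_interval C \<delta> \<rho> n \<alpha> x) / \<alpha>))
    \<le> ennreal (min (gauss_mix \<rho> (\<Sum>i=1..n. x i - \<mu>) (rws_u n x)) (C * real n powr (0.24 * \<delta>)))"
  using rws_loss_le[OF assms, of _ \<mu> C \<delta> x]
  by (intro SUP_least) (auto simp: of_bool_def intro!: ennreal_leI)

section \<open>Moment bounds for independent observations\<close>

text \<open>
  Separates the deterministic regularizer from the random sum of squares.
\<close>

lemma tilt_add_right: "tilt l s (q + a) = exp (- (l\<^sup>2 * a / 2)) * tilt l s q"
  by (simp add: tilt_def algebra_simps add_divide_distrib flip: exp_add)

text \<open>
  The bound \<open>exp_minus_half_square_le\<close> is integrated at \<open>l (x - \<mu>)\<close>; the linear term vanishes because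
  \<open>\<mu>\<close> is the mean. The exponent \<open>d\<close> may be smaller than \<open>\<delta>\<close> since it must not exceed 1; the summand 1
  in \<open>1 + B\<close> pays for \<open>\<bar>y\<bar>\<^bsup>2 + d\<^esup> \<le> 1 + \<bar>y\<bar>\<^bsup>2 + \<delta>\<^esup>\<close>.
\<close>

lemma nn_integral_tilt_law_le:
  fixes P :: "real measure" and \<mu> \<delta> d B l :: real
  assumes P: "P \<in> moment_class (2 + \<delta>) \<mu>" and B: "(LINT x|P. \<bar>x - \<mu>\<bar> powr (2 + \<delta>)) \<le> B"
    and d: "0 \<le> d" "d \<le> 1" "d \<le> \<delta>"
  shows "(\<integral>\<^sup>+x. ennreal (tilt l (x - \<mu>) ((x - \<mu>)\<^sup>2)) \<partial>P) \<le> ennreal (exp ((1 + B) * \<bar>l\<bar> powr (2 + d)))"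
proof -
  interpret prob_space P using P by (simp add: moment_class_def)
  have [simp]: "integrable P (\<lambda>x. x)" "(LINT x|P. x) = \<mu>" "integrable P (\<lambda>x. \<bar>x - \<mu>\<bar> powr (2 + \<delta>))"
    using P by (auto simp: moment_class_def)
  define g where "g x = 1 + l * (x - \<mu>) + \<bar>l\<bar> powr (2 + d) * (1 + \<bar>x - \<mu>\<bar> powr (2 + \<delta>))" for x
  have le: "tilt l (x - \<mu>) ((x - \<mu>)\<^sup>2) \<le> g x" for x
  proof -
    have "tilt l (x - \<mu>) ((x - \<mu>)\<^sup>2) = exp (l * (x - \<mu>) - (l * (x - \<mu>))\<^sup>2 / 2)"
      by (simp add: tilt_def power_mult_distrib)
    also have "\<dots> \<le> 1 + l * (x - \<mu>) + \<bar>l * (x - \<mu>)\<bar> powr (2 + d)"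
      using d by (intro exp_minus_half_square_le)
    also have "\<bar>l * (x - \<mu>)\<bar> powr (2 + d) = \<bar>l\<bar> powr (2 + d) * \<bar>x - \<mu>\<bar> powr (2 + d)"
      by (simp add: abs_mult powr_mult)
    also have "\<bar>x - \<mu>\<bar> powr (2 + d) \<le> 1 + \<bar>x - \<mu>\<bar> powr (2 + \<delta>)"
    proof (cases "\<bar>x - \<mu>\<bar> \<le> 1")
      case True
      then have "\<bar>x - \<mu>\<bar> powr (2 + d) \<le> 1" using d by (intro powr_le1) auto
      then show ?thesis by (simp add: add_increasing2)
    next
      case False
      then have "\<bar>x - \<mu>\<bar> powr (2 + d) \<le> \<bar>x - \<mu>\<bar> powr (2 + \<delta>)" using d by (intro powr_mono) auto
      then show ?thesis by simp
    qed
    finally show ?thesis by (simp add: g_def mult_left_mono)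
  qed
  have int: "integrable P g" unfolding g_def by simp
  have "(\<integral>\<^sup>+x. ennreal (tilt l (x - \<mu>) ((x - \<mu>)\<^sup>2)) \<partial>P) \<le> (\<integral>\<^sup>+x. ennreal (g x) \<partial>P)"
    by (intro nn_integral_mono ennreal_leI le)
  also have "\<dots> = ennreal (LINT x|P. g x)"
  proof (intro nn_integral_eq_integral int AE_I2)
    show "0 \<le> g x" for x using le[of x] by (intro order_trans[OF _ le]) (simp add: tilt_def)
  qed
  also have "(LINT x|P. g x) = 1 + \<bar>l\<bar> powr (2 + d) * (1 + (LINT x|P. \<bar>x - \<mu>\<bar> powr (2 + \<delta>)))"
    unfolding g_def by (simp add: prob_space)
  also have "\<dots> \<le> 1 + (1 + B) * \<bar>l\<bar> powr (2 + d)"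
    using B by (subst mult.commute[of "1 + B"]) (auto intro!: add_left_mono mult_left_mono)
  also have "\<dots> \<le> exp ((1 + B) * \<bar>l\<bar> powr (2 + d))" by simp
  finally show ?thesis by (simp add: ennreal_leI)
qed

lemma iid_with_lawD:
  assumes "iid_with_law S X P" "i \<ge> 1"
  shows "X i \<in> borel_measurable S"
    and "f \<in> borel_measurable borel \<Longrightarrow> (\<integral>\<^sup>+\<omega>. f (X i \<omega>) \<partial>S) = (\<integral>\<^sup>+x. f x \<partial>P)"
proof -
  interpret prob_space S using assms by (simp add: iid_with_law_def)
  show m: "X i \<in> borel_measurable S"
    using assms by (auto simp: iid_with_law_def indep_vars_def)
  have P: "P = distr S borel (X i)" using assms by (simp add: iid_with_law_def)
  show "(\<integral>\<^sup>+\<omega>. f (X i \<omega>) \<partial>S) = (\<integral>\<^sup>+x. f x \<partial>P)" if "f \<in> borel_measurable borel"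
    unfolding P using that m by (subst nn_integral_distr) auto
qed

text \<open>
  The tilt of the sums is the product of the tilts of the independent summands.
\<close>

lemma nn_integral_tilt_sum_le:
  fixes X :: "nat \<Rightarrow> 'a \<Rightarrow> real" and \<mu> c l :: real
  assumes iid: "iid_with_law S X P"
    and c: "(\<integral>\<^sup>+x. ennreal (tilt l (x - \<mu>) ((x - \<mu>)\<^sup>2)) \<partial>P) \<le> ennreal c"
  shows "(\<integral>\<^sup>+\<omega>. ennreal (tilt l (\<Sum>i=1..n. X i \<omega> - \<mu>) (\<Sum>i=1..n. (X i \<omega> - \<mu>)\<^sup>2)) \<partial>S) \<le> ennreal c ^ n"
proof -
  interpret prob_space S using iid by (simp add: iid_with_law_def)
  define f where "f x = ennreal (tilt l (x - \<mu>) ((x - \<mu>)\<^sup>2))" for x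
  have f [measurable]: "f \<in> borel_measurable borel" unfolding f_def tilt_def by measurable
  have "indep_vars (\<lambda>_. borel) X {1..n}"
    using iid by (intro indep_vars_subset[where I = "{1..}" and J = "{1..n}"]) (auto simp: iid_with_law_def)
  then have ind: "indep_vars (\<lambda>_. borel) (\<lambda>i \<omega>. f (X i \<omega>)) {1..n}"
    by (rule indep_vars_compose2) (simp add: f)
  have "tilt l (\<Sum>i=1..n. y i) (\<Sum>i=1..n. (y i)\<^sup>2) = (\<Prod>i=1..n. tilt l (y i) ((y i)\<^sup>2))" for y :: "nat \<Rightarrow> real"
    by (simp add: tilt_def sum_distrib_left sum_divide_distrib flip: sum_subtractf exp_sum)
  then have "(\<integral>\<^sup>+\<omega>. ennreal (tilt l (\<Sum>i=1..n. X i \<omega> - \<mu>) (\<Sum>i=1..n. (X i \<omega> - \<mu>)\<^sup>2)) \<partial>S)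
      = (\<integral>\<^sup>+\<omega>. (\<Prod>i=1..n. f (X i \<omega>)) \<partial>S)"
    by (simp add: f_def prod_ennreal tilt_def)
  also have "\<dots> = (\<Prod>i=1..n. \<integral>\<^sup>+\<omega>. f (X i \<omega>) \<partial>S)"
    by (intro indep_vars_nn_integral ind) auto
  also have "\<dots> = (\<Prod>i=1..n. \<integral>\<^sup>+x. f x \<partial>P)"
    by (intro prod.cong refl iid_with_lawD(2)[OF iid] f) auto
  also have "\<dots> = (\<integral>\<^sup>+x. f x \<partial>P) ^ n" by simp
  also have "\<dots> \<le> ennreal c ^ n" using c unfolding f_def by (intro power_mono) auto
  finally show ?thesis .
qed

text \<open>
  On the event, the power mean inequality with exponent \<open>1 + \<delta> / 2\<close> bounds \<open>t\<^bsup>1 + \<delta>/2\<^esup>\<close> by the mean of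
  the \<open>\<bar>X i - \<mu>\<bar>\<^bsup>2 + \<delta>\<^esup>\<close>, whose expectation is at most \<open>B\<close>. The bound does not depend on \<open>n\<close>;
  it decays in \<open>n\<close> only through the choice of \<open>t\<close>.
\<close>

lemma nn_integral_sum_squares_large_le:
  fixes X :: "nat \<Rightarrow> 'a \<Rightarrow> real" and \<mu> \<delta> B t :: real
  assumes iid: "iid_with_law S X P" and P: "P \<in> moment_class (2 + \<delta>) \<mu>"
    and B: "(LINT x|P. \<bar>x - \<mu>\<bar> powr (2 + \<delta>)) \<le> B" and "\<delta> > 0" "t > 0" "n > 0"
  shows "(\<integral>\<^sup>+\<omega>. ennreal (of_bool (t * real n < (\<Sum>i=1..n. (X i \<omega> - \<mu>)\<^sup>2))) \<partial>S)
    \<le> ennreal (B * t powr (- (1 + \<delta> / 2)))"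
proof -
  define p where "p = 1 + \<delta> / 2"
  define f where "f x = ennreal (\<bar>x - \<mu>\<bar> powr (2 + \<delta>))" for x
  have f [measurable]: "f \<in> borel_measurable borel" unfolding f_def by measurable
  have [measurable]: "(\<lambda>\<omega>. f (X i \<omega>)) \<in> borel_measurable S" if "i \<in> {1..n}" for i
    using iid_with_lawD(1)[OF iid, of i] that by simp
  have sq: "(y\<^sup>2) powr p = \<bar>y\<bar> powr (2 + \<delta>)" for y :: real
    using powr_powr[of "\<bar>y\<bar>" 2 p] by (simp add: p_def algebra_simps)
  have pw: "ennreal (of_bool (t * real n < (\<Sum>i=1..n. (X i \<omega> - \<mu>)\<^sup>2)))
      \<le> ennreal (t powr (- p) / real n) * (\<Sum>i=1..n. f (X i \<omega>))" for \<omega>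
  proof (cases "t * real n < (\<Sum>i=1..n. (X i \<omega> - \<mu>)\<^sup>2)")
    case True
    have "t powr p \<le> (\<Sum>i=1..n. ((X i \<omega> - \<mu>)\<^sup>2) powr p) / real n"
      using True assms by (intro powr_mean_le_mean_powr) (auto simp: p_def)
    then have "t powr (- p) * t powr p \<le> t powr (- p) * ((\<Sum>i=1..n. ((X i \<omega> - \<mu>)\<^sup>2) powr p) / real n)"
      by (intro mult_left_mono) auto
    then have "1 \<le> t powr (- p) / real n * (\<Sum>i=1..n. \<bar>X i \<omega> - \<mu>\<bar> powr (2 + \<delta>))"
      using \<open>t > 0\<close> by (simp add: sq flip: powr_add)
    then have "ennreal 1 \<le> ennreal (t powr (- p) / real n * (\<Sum>i=1..n. \<bar>X i \<omega> - \<mu>\<bar> powr (2 + \<delta>)))"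
      by (rule ennreal_leI)
    then show ?thesis using True
      by (simp add: f_def sum_nonneg flip: ennreal_mult)
  qed simp
  have Pf: "(\<integral>\<^sup>+x. f x \<partial>P) \<le> ennreal B"
    unfolding f_def using P B
    by (subst nn_integral_eq_integral) (auto simp: moment_class_def ennreal_leI)
  have "(\<integral>\<^sup>+\<omega>. ennreal (of_bool (t * real n < (\<Sum>i=1..n. (X i \<omega> - \<mu>)\<^sup>2))) \<partial>S)
      \<le> (\<integral>\<^sup>+\<omega>. ennreal (t powr (- p) / real n) * (\<Sum>i=1..n. f (X i \<omega>)) \<partial>S)"
    by (intro nn_integral_mono pw)
  also have "\<dots> = ennreal (t powr (- p) / real n) * (\<Sum>i=1..n. \<integral>\<^sup>+\<omega>. f (X i \<omega>) \<partial>S)"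
    by (subst nn_integral_cmult, measurable) (subst nn_integral_sum, auto)
  also have "(\<Sum>i=1..n. \<integral>\<^sup>+\<omega>. f (X i \<omega>) \<partial>S) = (\<Sum>i=1..n. \<integral>\<^sup>+x. f x \<partial>P)"
    by (intro sum.cong refl iid_with_lawD(2)[OF iid] f) auto
  also have "\<dots> \<le> (\<Sum>i=1..n. ennreal B)" by (intro sum_mono Pf)
  also have "\<dots> = ennreal (real n * B)" by (simp add: ennreal_mult'' ennreal_of_nat_eq_real_of_nat ennreal_mult')
  also have "ennreal (t powr (- p) / real n) * \<dots> = ennreal (t powr (- p) / real n * (real n * B))"
    by (rule ennreal_mult'[symmetric]) simp
  also have "t powr (- p) / real n * (real n * B) = B * t powr (- p)" using \<open>n > 0\<close> by simp
  finally show ?thesis by (simp add: p_def mult_left_mono)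
qed

section \<open>Bounding the risk\<close>

text \<open>
  A bound at fixed \<open>n\<close>, obtained by integrating \<open>capped_gauss_mix_le\<close>. Condition \<open>L\<close> makes the
  tilts with \<open>\<bar>l\<bar> \<le> L\<close> integrate to at most 1, and condition \<open>T\<close> ensures that \<open>v \<le> u\<close> in the
  third case.
\<close>

lemma post_hoc_risk_rws_le:
  fixes X :: "nat \<Rightarrow> 'a \<Rightarrow> real" and \<mu> \<delta> \<rho> C B d L t :: real and n :: nat
  assumes iid: "iid_with_law S X P" and P: "P \<in> moment_class (2 + \<delta>) \<mu>"
    and B: "(LINT x|P. \<bar>x - \<mu>\<bar> powr (2 + \<delta>)) \<le> B"
    and "\<delta> > 0" "\<rho> > 0" "C > 0" "n \<ge> 2" "L > 0" "t > 0"
    and d: "0 \<le> d" "d \<le> 1" "d \<le> \<delta>"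
    and L: "(1 + B) * L powr d * ln (real n) \<le> 1 / 4"
    and T: "(t * real n + real n / (2 * ln (real n))) * L / 2 \<le> real n / sqrt (2 * ln (real n))"
  defines "K \<equiv> C * real n powr (0.24 * \<delta>)"
  shows "post_hoc_risk S \<mu> (\<lambda>\<alpha> \<omega>. rws_interval C \<delta> \<rho> n \<alpha> (\<lambda>i. X i \<omega>))
    \<le> ennreal (1 + K * B * t powr (- (1 + \<delta> / 2)) + 2 * K * exp (- (real n * L\<^sup>2 / (16 * ln (real n)))))"
proof -
  interpret prob_space S using iid by (simp add: iid_with_law_def)
  define h where "h = ln (real n)"
  have h: "h > 0" using \<open>n \<ge> 2\<close> by (simp add: h_def)
  have K: "K > 0" using assms by (simp add: K_def)
  have B0: "B \<ge> 0" by (rule order_trans[OF _ B]) simp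
  define s where "s \<omega> = (\<Sum>i=1..n. X i \<omega> - \<mu>)" for \<omega>
  define q where "q \<omega> = (\<Sum>i=1..n. (X i \<omega> - \<mu>)\<^sup>2)" for \<omega>
  define v where "v \<omega> = q \<omega> + real n / (2 * h)" for \<omega>
  have X [measurable]: "X i \<in> borel_measurable S" if "i \<in> {1..n}" for i
    using iid_with_lawD(1)[OF iid, of i] that by simp
  have [measurable]: "s \<in> borel_measurable S" "q \<in> borel_measurable S"
    unfolding s_def q_def by measurable
  have [measurable]: "v \<in> borel_measurable S" unfolding v_def by measurable
  have tilt_meas: "(\<lambda>\<omega>. tilt l (s \<omega>) (v \<omega>)) \<in> borel_measurable S" for l
    unfolding tilt_def by measurable

  \<comment> \<open>Half of the regularizer compensates the expectation of the tilt by the sum of squares.\<close>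
  have tilt_le: "(\<integral>\<^sup>+\<omega>. ennreal (tilt l (s \<omega>) (v \<omega>)) \<partial>S) \<le> 1" if l: "\<bar>l\<bar> \<le> L" for l
  proof -
    have "(\<integral>\<^sup>+\<omega>. ennreal (tilt l (s \<omega>) (v \<omega>)) \<partial>S)
        = (\<integral>\<^sup>+\<omega>. ennreal (exp (- (l\<^sup>2 * (real n / (2 * h)) / 2))) * ennreal (tilt l (s \<omega>) (q \<omega>)) \<partial>S)"
      unfolding v_def tilt_add_right by (simp add: ennreal_mult')
    also have "\<dots> = ennreal (exp (- (l\<^sup>2 * (real n / (2 * h)) / 2))) * (\<integral>\<^sup>+\<omega>. ennreal (tilt l (s \<omega>) (q \<omega>)) \<partial>S)"
      unfolding tilt_def by (intro nn_integral_cmult) measurable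
    also have "\<dots> \<le> ennreal (exp (- (l\<^sup>2 * (real n / (2 * h)) / 2))) * ennreal (exp ((1 + B) * \<bar>l\<bar> powr (2 + d))) ^ n"
      unfolding s_def q_def
      by (intro mult_left_mono nn_integral_tilt_sum_le[OF iid] nn_integral_tilt_law_le[OF P B d]) auto
    also have "\<dots> = ennreal (exp (real n * ((1 + B) * \<bar>l\<bar> powr (2 + d)) - l\<^sup>2 * (real n / (2 * h)) / 2))"
      by (simp add: ennreal_power flip: ennreal_mult' exp_of_nat_mult exp_add)
    also have "\<dots> \<le> ennreal 1"
    proof (intro ennreal_leI)
      have "\<bar>l\<bar> powr (2 + d) = l\<^sup>2 * \<bar>l\<bar> powr d"
        by (cases "l = 0") (auto simp: powr_add)
      also have "\<dots> \<le> l\<^sup>2 * L powr d"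
        using l d by (intro mult_left_mono powr_mono2) auto
      finally have "(1 + B) * \<bar>l\<bar> powr (2 + d) \<le> (1 + B) * (l\<^sup>2 * L powr d)"
        using B0 by (intro mult_left_mono) auto
      also have "\<dots> = l\<^sup>2 * ((1 + B) * L powr d)" by simp
      also have "(1 + B) * L powr d \<le> 1 / (4 * h)"
        using L h by (simp add: h_def field_simps)
      finally have "(1 + B) * \<bar>l\<bar> powr (2 + d) \<le> l\<^sup>2 * (1 / (4 * h))" by (simp add: mult_left_mono)
      then have "real n * ((1 + B) * \<bar>l\<bar> powr (2 + d)) \<le> real n * (l\<^sup>2 * (1 / (4 * h)))"
        by (intro mult_left_mono) auto
      then show "exp (real n * ((1 + B) * \<bar>l\<bar> powr (2 + d)) - l\<^sup>2 * (real n / (2 * h)) / 2) \<le> 1"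
        by (simp add: mult_ac)
    qed
    finally show ?thesis by simp
  qed

  define a where "a = K * exp (- (real n * L\<^sup>2 / (16 * h)))"
  define k where "k l \<omega> = ennreal (normal_density 0 (sqrt \<rho>) l *
      (if \<bar>l\<bar> \<le> L then tilt l (s \<omega>) (v \<omega>) else 1))" for l \<omega>
  have k_meas: "case_prod k \<in> borel_measurable (lborel \<Otimes>\<^sub>M S)"
    unfolding k_def tilt_def by measurable
  \<comment> \<open>Tonelli reduces the expectation of the truncated mixture to those of the single tilts.\<close>
  have k_le: "(\<integral>\<^sup>+\<omega>. (\<integral>\<^sup>+l. k l \<omega> \<partial>lborel) \<partial>S) \<le> 1"
  proof -
    interpret pair_sigma_finite lborel S by unfold_locales
    have "(\<integral>\<^sup>+\<omega>. (\<integral>\<^sup>+l. k l \<omega> \<partial>lborel) \<partial>S) = (\<integral>\<^sup>+l. (\<integral>\<^sup>+\<omega>. k l \<omega> \<partial>S) \<partial>lborel)"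
      by (rule Fubini'[OF k_meas])
    also have "\<dots> \<le> (\<integral>\<^sup>+l. ennreal (normal_density 0 (sqrt \<rho>) l) \<partial>lborel)"
    proof (intro nn_integral_mono)
      fix l :: real
      have "(\<integral>\<^sup>+\<omega>. k l \<omega> \<partial>S) = ennreal (normal_density 0 (sqrt \<rho>) l) *
          (\<integral>\<^sup>+\<omega>. (if \<bar>l\<bar> \<le> L then ennreal (tilt l (s \<omega>) (v \<omega>)) else 1) \<partial>S)"
        unfolding k_def using tilt_meas
        by (subst nn_integral_cmult[symmetric])
           (auto simp: ennreal_mult' normal_density_nonneg intro!: nn_integral_cong)
      also have "\<dots> \<le> ennreal (normal_density 0 (sqrt \<rho>) l) * 1"
        using tilt_le[of l] by (intro mult_left_mono) (cases "\<bar>l\<bar> \<le> L"; simp add: emeasure_space_1)+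
      finally show "(\<integral>\<^sup>+\<omega>. k l \<omega> \<partial>S) \<le> ennreal (normal_density 0 (sqrt \<rho>) l)" by simp
    qed
    also have "\<dots> = 1" using \<open>\<rho> > 0\<close> by (simp add: nn_integral_normal_density_eq_1)
    finally show ?thesis .
  qed

  have loss: "(SUP \<alpha>\<in>{0<..}. ennreal (of_bool (\<mu> \<notin> rws_interval C \<delta> \<rho> n \<alpha> (\<lambda>i. X i \<omega>)) / \<alpha>))
      \<le> ennreal (K * of_bool (t * real n < q \<omega>))
        + ennreal a * (ennreal (tilt (L/2) (s \<omega>) (v \<omega>)) + ennreal (tilt (-L/2) (s \<omega>) (v \<omega>)))
        + (\<integral>\<^sup>+l. k l \<omega> \<partial>lborel)" for \<omega>
  proof -
    have u: "rws_u n (\<lambda>i. X i \<omega>) = q \<omega> - (s \<omega>)\<^sup>2 / real n + real n / h"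
      using \<open>n \<ge> 2\<close> by (simp add: rws_u_eq[of n _ \<mu>] q_def s_def h_def)
    have "(SUP \<alpha>\<in>{0<..}. ennreal (of_bool (\<mu> \<notin> rws_interval C \<delta> \<rho> n \<alpha> (\<lambda>i. X i \<omega>)) / \<alpha>))
        \<le> ennreal (min (gauss_mix \<rho> (s \<omega>) (q \<omega> - (s \<omega>)\<^sup>2 / real n + real n / h)) K)"
      using SUP_rws_loss_le[OF \<open>\<rho> > 0\<close> \<open>n \<ge> 2\<close>, of \<mu> C \<delta> "\<lambda>i. X i \<omega>"]
      unfolding u K_def by (simp add: s_def)
    also have "\<dots> \<le> ennreal (K * of_bool (t * real n < q \<omega>))
        + ennreal a * (ennreal (tilt (L/2) (s \<omega>) (v \<omega>)) + ennreal (tilt (-L/2) (s \<omega>) (v \<omega>)))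
        + (\<integral>\<^sup>+l. k l \<omega> \<partial>lborel)"
      unfolding k_def a_def v_def using assms h K T[folded h_def]
      by (intro capped_gauss_mix_le) (auto simp: q_def sum_nonneg)
    finally show ?thesis .
  qed
  have "post_hoc_risk S \<mu> (\<lambda>\<alpha> \<omega>. rws_interval C \<delta> \<rho> n \<alpha> (\<lambda>i. X i \<omega>))
      \<le> (\<integral>\<^sup>+\<omega>. ennreal (K * of_bool (t * real n < q \<omega>))
        + ennreal a * (ennreal (tilt (L/2) (s \<omega>) (v \<omega>)) + ennreal (tilt (-L/2) (s \<omega>) (v \<omega>)))
        + (\<integral>\<^sup>+l. k l \<omega> \<partial>lborel) \<partial>S)"
    unfolding post_hoc_risk_def by (intro nn_integral_mono loss)
  also have "\<dots> = (\<integral>\<^sup>+\<omega>. ennreal K * ennreal (of_bool (t * real n < q \<omega>)) \<partial>S)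
      + ennreal a * ((\<integral>\<^sup>+\<omega>. ennreal (tilt (L/2) (s \<omega>) (v \<omega>)) \<partial>S) + (\<integral>\<^sup>+\<omega>. ennreal (tilt (-L/2) (s \<omega>) (v \<omega>)) \<partial>S))
      + (\<integral>\<^sup>+\<omega>. (\<integral>\<^sup>+l. k l \<omega> \<partial>lborel) \<partial>S)"
  proof -
    have [measurable]: "(\<lambda>\<omega>. \<integral>\<^sup>+l. k l \<omega> \<partial>lborel) \<in> borel_measurable S"
      using k_meas unfolding k_def by measurable
    note [measurable] = tilt_meas
    show ?thesis using K by (simp add: nn_integral_add nn_integral_cmult ennreal_mult)
  qed
  also have "(\<integral>\<^sup>+\<omega>. ennreal K * ennreal (of_bool (t * real n < q \<omega>)) \<partial>S)
      = ennreal K * (\<integral>\<^sup>+\<omega>. ennreal (of_bool (t * real n < q \<omega>)) \<partial>S)"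
    by (intro nn_integral_cmult) measurable
  also have "\<dots> + ennreal a * ((\<integral>\<^sup>+\<omega>. ennreal (tilt (L/2) (s \<omega>) (v \<omega>)) \<partial>S) + (\<integral>\<^sup>+\<omega>. ennreal (tilt (-L/2) (s \<omega>) (v \<omega>)) \<partial>S))
      + (\<integral>\<^sup>+\<omega>. (\<integral>\<^sup>+l. k l \<omega> \<partial>lborel) \<partial>S)
      \<le> ennreal K * ennreal (B * t powr (- (1 + \<delta> / 2))) + ennreal a * (1 + 1) + 1"
    unfolding q_def using assms
    by (intro add_mono mult_left_mono nn_integral_sum_squares_large_le[OF iid P B] tilt_le k_le) auto
  also have "\<dots> = ennreal (1 + K * B * t powr (- (1 + \<delta> / 2)) + 2 * a)"
    using K B0 by (simp add: a_def ennreal_mult' ennreal_plus mult_ac add_ac flip: numeral_plus_one)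
  finally show ?thesis by (simp add: a_def h_def mult.assoc)
qed

text \<open>
  The choices are \<open>L = n\<^bsup>-0.49\<^esup>\<close> and \<open>t = n\<^bsup>0.48\<^esup>\<close>. With \<open>L = n\<^bsup>-b\<^esup>\<close> and \<open>t = n\<^bsup>e\<^esup>\<close>, condition \<open>T\<close> asks for
  \<open>e < b\<close>, the exponential term vanishes for \<open>b < 1/2\<close>, and the moment term is of order
  \<open>n\<^bsup>0.24 \<delta> - e (1 + \<delta>/2)\<^esup>\<close>, which tends to 0 for every \<open>\<delta>\<close> once \<open>e \<ge> 0.48\<close>.
\<close>

lemma post_hoc_risk_rws_uniform_limit:
  fixes X :: "nat \<Rightarrow> 'a \<Rightarrow> real" and M :: "real measure \<Rightarrow> 'a measure" and \<mu> \<delta> C \<rho> B :: real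
  assumes "\<delta> > 0" "C > 0" "\<rho> > 0"
    and iid: "\<And>P. P \<in> \<Q> \<Longrightarrow> iid_with_law (M P) X P"
    and \<Q>: "\<Q> \<subseteq> moment_class (2 + \<delta>) \<mu>"
    and B: "\<And>P. P \<in> \<Q> \<Longrightarrow> (LINT x|P. \<bar>x - \<mu>\<bar> powr (2 + \<delta>)) \<le> B"
  shows "limsup (\<lambda>n. SUP P\<in>\<Q>. post_hoc_risk (M P) \<mu> (\<lambda>\<alpha> \<omega>. rws_interval C \<delta> \<rho> n \<alpha> (\<lambda>i. X i \<omega>))) \<le> 1"
proof -
  define d where "d = min \<delta> 1"
  have d: "0 \<le> d" "d \<le> 1" "d \<le> \<delta>" "0 < d" using \<open>\<delta> > 0\<close> by (auto simp: d_def)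
  define r where "r n = 1 + C * real n powr (0.24 * \<delta>) * B * (real n powr 0.48) powr (- (1 + \<delta> / 2))
      + 2 * (C * real n powr (0.24 * \<delta>)) * exp (- (real n * (real n powr (-0.49))\<^sup>2 / (16 * ln (real n))))" for n :: nat
  have r: "r \<longlonglongrightarrow> 1"
  proof (rule Lim_transform_eventually)
    show "(\<lambda>n. 1 + C * B * real n powr (-0.48)
        + 2 * C * real n powr (0.24 * \<delta>) * exp (- (real n powr 0.02 / (16 * ln (real n))))) \<longlonglongrightarrow> 1"
      using \<open>\<delta> > 0\<close> \<open>C > 0\<close> by real_asymp
    show "\<forall>\<^sub>F n in sequentially. 1 + C * B * real n powr (-0.48)
        + 2 * C * real n powr (0.24 * \<delta>) * exp (- (real n powr 0.02 / (16 * ln (real n)))) = r n"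
      using eventually_gt_at_top[of 0]
    proof eventually_elim
      case (elim n)
      have "real n powr (0.24 * \<delta>) * (real n powr 0.48) powr (- (1 + \<delta> / 2)) = real n powr (-0.48)"
        unfolding powr_powr powr_add[symmetric] by (rule arg_cong[where f = "\<lambda>e. real n powr e"]) (simp add: field_simps)
      moreover have "real n * (real n powr (-0.49))\<^sup>2 = real n powr 1 * (real n powr (-0.49)) powr 2"
        using elim by simp
      then have "real n * (real n powr (-0.49))\<^sup>2 = real n powr 0.02"
        by (simp only: powr_powr flip: powr_add) simp
      ultimately show ?case unfolding r_def by (simp add: mult_ac)
    qed
  qed
  have "(\<lambda>n. (1 + B) * (real n powr (-0.49)) powr d * ln (real n)) \<longlonglongrightarrow> 0"
    using d by real_asymp
  then have "\<forall>\<^sub>F n in sequentially. (1 + B) * (real n powr (-0.49)) powr d * ln (real n) < 1 / 4"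
    by (rule order_tendstoD) simp
  moreover have "\<forall>\<^sub>F n in sequentially. (real n powr 0.48 * real n + real n / (2 * ln (real n))) * real n powr (-0.49) / 2
      \<le> real n / sqrt (2 * ln (real n))" by real_asymp
  ultimately have "\<forall>\<^sub>F n in sequentially.
      (SUP P\<in>\<Q>. post_hoc_risk (M P) \<mu> (\<lambda>\<alpha> \<omega>. rws_interval C \<delta> \<rho> n \<alpha> (\<lambda>i. X i \<omega>))) \<le> ennreal (r n)"
    using eventually_ge_at_top[of 2]
  proof eventually_elim
    case (elim n)
    show ?case
    proof (intro SUP_least)
      fix P assume "P \<in> \<Q>"
      then show "post_hoc_risk (M P) \<mu> (\<lambda>\<alpha> \<omega>. rws_interval C \<delta> \<rho> n \<alpha> (\<lambda>i. X i \<omega>)) \<le> ennreal (r n)"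
        unfolding r_def using assms elim d \<Q>
        by (intro post_hoc_risk_rws_le) auto
    qed
  qed
  then have "limsup (\<lambda>n. SUP P\<in>\<Q>. post_hoc_risk (M P) \<mu> (\<lambda>\<alpha> \<omega>. rws_interval C \<delta> \<rho> n \<alpha> (\<lambda>i. X i \<omega>)))
      \<le> limsup (\<lambda>n. ennreal (r n))"
    by (rule Limsup_mono)
  also have "\<dots> = 1"
    using tendsto_ennrealI[OF r] by (intro lim_imp_Limsup) auto
  finally show ?thesis .
qed

lemma uniformly_bounded_moment_centered:
  assumes "uniformly_bounded_moment \<P> q" "\<P> \<subseteq> moment_class q \<mu>" "q > 0"
  obtains B where "\<And>P. P \<in> \<P> \<Longrightarrow> (LINT x|P. \<bar>x - \<mu>\<bar> powr q) \<le> B"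
proof -
  define c where "c = (SUP P\<in>\<P>. \<integral>\<^sup>+x. ennreal (\<bar>x\<bar> powr q) \<partial>P)"
  have c: "c < \<infinity>" using assms by (simp add: c_def uniformly_bounded_moment_def)
  define b where "b = ennreal (2 powr q) * c + ennreal ((2 * \<bar>\<mu>\<bar>) powr q)"
  have b: "b < \<infinity>" using c by (simp add: b_def ennreal_mult_less_top)
  show thesis
  proof (rule that)
    fix P assume P: "P \<in> \<P>"
    then have cls: "P \<in> moment_class q \<mu>" using assms by auto
    then interpret prob_space P by (simp add: moment_class_def)
    have [measurable_cong]: "sets P = sets borel" using cls by (simp add: moment_class_def)
    have "\<bar>x - \<mu>\<bar> powr q \<le> 2 powr q * \<bar>x\<bar> powr q + (2 * \<bar>\<mu>\<bar>) powr q" for x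
    proof -
      have "\<bar>x - \<mu>\<bar> powr q \<le> (2 * max \<bar>x\<bar> \<bar>\<mu>\<bar>) powr q"
        using \<open>q > 0\<close> by (intro powr_mono2) auto
      also have "\<dots> \<le> (2 * \<bar>x\<bar>) powr q + (2 * \<bar>\<mu>\<bar>) powr q" by (simp add: max_def)
      finally show ?thesis by (simp add: powr_mult)
    qed
    then have "(\<integral>\<^sup>+x. ennreal (\<bar>x - \<mu>\<bar> powr q) \<partial>P)
        \<le> (\<integral>\<^sup>+x. ennreal (2 powr q) * ennreal (\<bar>x\<bar> powr q) + ennreal ((2 * \<bar>\<mu>\<bar>) powr q) \<partial>P)"
      by (intro nn_integral_mono) (simp flip: ennreal_mult ennreal_plus)
    also have "\<dots> = ennreal (2 powr q) * (\<integral>\<^sup>+x. ennreal (\<bar>x\<bar> powr q) \<partial>P) + ennreal ((2 * \<bar>\<mu>\<bar>) powr q)"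
      by (simp add: nn_integral_add nn_integral_cmult emeasure_space_1)
    also have "\<dots> \<le> b"
      unfolding b_def c_def using P by (intro add_mono mult_left_mono SUP_upper) auto
    finally have "ennreal (LINT x|P. \<bar>x - \<mu>\<bar> powr q) \<le> b"
      using cls by (subst (asm) nn_integral_eq_integral) (auto simp: moment_class_def)
    then have "enn2real (ennreal (LINT x|P. \<bar>x - \<mu>\<bar> powr q)) \<le> enn2real b"
      using b by (intro enn2real_mono) auto
    then show "(LINT x|P. \<bar>x - \<mu>\<bar> powr q) \<le> enn2real b" by simp
  qed
qed

section \<open>Asymptotic post-hoc validity\<close>

theorem theorem3p10:
  fixes \<mu> \<delta> C \<rho> :: real
    and M :: "real measure \<Rightarrow> 'a measure"
    and X :: "nat \<Rightarrow> 'a \<Rightarrow> real"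
  assumes "\<delta> > 0" and "C > 0" and "\<rho> > 0"
    and "\<And>P. P \<in> moment_class (2 + \<delta>) \<mu> \<Longrightarrow> iid_with_law (M P) X P"
  defines "H \<equiv> (\<lambda>n \<alpha> \<omega>. rws_interval C \<delta> \<rho> n \<alpha> (\<lambda>i. X i \<omega>))"
  shows "asymp_post_hoc_CI M \<mu> (moment_class (2 + \<delta>) \<mu>) H \<and>
    (\<forall>\<P>. \<P> \<subseteq> moment_class (2 + \<delta>) \<mu> \<and> uniformly_bounded_moment \<P> (2 + \<delta>) \<longrightarrow>
       uniform_asymp_post_hoc_CI M \<mu> \<P> H)"
proof (intro conjI allI impI)
  show "asymp_post_hoc_CI M \<mu> (moment_class (2 + \<delta>) \<mu>) H"
    unfolding asymp_post_hoc_CI_def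
  proof (intro SUP_least)
    fix P assume "P \<in> moment_class (2 + \<delta>) \<mu>"
    then have "limsup (\<lambda>n. SUP P'\<in>{P}. post_hoc_risk (M P') \<mu> (H n)) \<le> 1"
      unfolding H_def using assms by (intro post_hoc_risk_rws_uniform_limit) auto
    then show "limsup (\<lambda>n. post_hoc_risk (M P) \<mu> (H n)) \<le> 1" by simp
  qed
next
  fix \<P> assume *: "\<P> \<subseteq> moment_class (2 + \<delta>) \<mu> \<and> uniformly_bounded_moment \<P> (2 + \<delta>)"
  then obtain B where "\<And>P. P \<in> \<P> \<Longrightarrow> (LINT x|P. \<bar>x - \<mu>\<bar> powr (2 + \<delta>)) \<le> B"
    using uniformly_bounded_moment_centered[of \<P> "2 + \<delta>" \<mu>] assms by auto
  then show "uniform_asymp_post_hoc_CI M \<mu> \<P> H"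
    unfolding uniform_asymp_post_hoc_CI_def H_def
    using assms * by (intro post_hoc_risk_rws_uniform_limit[where B = B]) auto
qed

end
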